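(* Let $(C,\phi,F)$ be a semicoherent $n$-component system with $C=\{1,\ldots,n\}$ whose component lifetimes $T_1,\ldots,T_n$ have no ties. For every nonempty set $M\subseteq C$ with $m=|M|$ and every $k\in\{1,\ldots,m\}$, the probability $p_M^{(k)}=\Pr(T_C=T_{k:M})$ satisfies $$ p_M^{(k)} = \sum_{j\in M}\ \sum_{A\subseteq C,\ |(M\setminus A)\cup\{j\}|=k} (-1)^{|\{j\}\setminus A|}\, q_j(A\setminus\{j\})\,\phi(A). $$
   Context: $C=\{1,\ldots,n\}$ is the set of components. $T_1,\ldots,T_n$ are nonnegative real random variables on a common probability space (the component lifetimes), with joint c.d.f. $F$, and there are no ties: $\Pr(T_i=T_j)=0$ for all distinct $i,j\in C$. No independence is assumed. The structure function $\phi\colon\{0,1\}^n\to\{0,1\}$ is identified with a set function $\phi\colon 2^C\to\{0,1\}$ (identify $(x_1,\ldots,x_n)$ with $A=\{i: x_i=1\}$). The system is semicoherent: $\phi$ is nondecreasing in each variable, $\phi(\varnothing)=0$ and $\phi(C)=1$. The system lifetime is $T_C=\max_{A\subseteq C,\ \phi(A)=1}\min_{i\in A}T_i$. For nonempty $M\subseteq C$ with $m=|M|$, $T_{k:M}$ is the $k$th smallest of the variables $T_i$, $i\in M$ ($k$th order statistic). For $j\in C$ and $A\subseteq C\setminus\{j\}$: $q_j(A)=\Pr\big(\max_{i\in C\setminus A}T_i=T_j<\min_{i\in A}T_i\big)$. The minimum over the empty set is $+\infty$. *)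

theory Defs
  imports "HOL-Probability.Probability"
begin

text \<open>A structure function \<open>{0,1}\<^sup>n \<rightarrow> {0,1}\<close> is given as a set function \<open>\<phi>\<close> on the
  subsets of \<open>C\<close>, a 0-1 vector \<open>x\<close> being identified with \<open>{i. x\<^sub>i = 1}\<close>.
  The third conjunct is monotonicity in the variable \<open>i\<close>. Values of \<open>\<phi>\<close> outside \<open>Pow C\<close>
  are irrelevant.\<close>

definition semicoherent :: "'i set \<Rightarrow> ('i set \<Rightarrow> nat) \<Rightarrow> bool" where
  "semicoherent C \<phi> \<longleftrightarrow>
     finite C \<and>
     (\<forall>A. A \<subseteq> C \<longrightarrow> \<phi> A \<in> {0, 1}) \<and>
     (\<forall>A i. A \<subseteq> C \<longrightarrow> i \<in> C \<longrightarrow> \<phi> (A - {i}) \<le> \<phi> (A \<union> {i})) \<and>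
     \<phi> {} = 0 \<and> \<phi> C = 1"

text \<open>In a semicoherent system the empty set is not among the sets \<open>A\<close> below and \<open>C\<close> is, so
  all minima and the maximum are over nonempty finite sets.\<close>

definition system_lifetime ::
    "'i set \<Rightarrow> ('i set \<Rightarrow> nat) \<Rightarrow> ('i \<Rightarrow> 'a \<Rightarrow> real) \<Rightarrow> 'a \<Rightarrow> real" where
  "system_lifetime C \<phi> T \<omega> = Max ((\<lambda>A. Min ((\<lambda>i. T i \<omega>) ` A)) ` {A. A \<subseteq> C \<and> \<phi> A = 1})"

text \<open>The \<open>k\<close>-th smallest (\<open>1 \<le> k \<le> card M\<close>) of the values \<open>T i \<omega>\<close>, \<open>i \<in> M\<close>, counted with
  multiplicity; list indices start at 0.\<close>

definition order_statistic ::
    "('i::linorder \<Rightarrow> 'a \<Rightarrow> real) \<Rightarrow> 'i set \<Rightarrow> nat \<Rightarrow> 'a \<Rightarrow> real" where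
  "order_statistic T M k \<omega> = sort (map (\<lambda>i. T i \<omega>) (sorted_list_of_set M)) ! (k - 1)"

text \<open>The minimum over \<open>A\<close> is an infimum in the extended reals, so that it is \<open>\<infinity>\<close> for empty
  \<open>A\<close>. Intended for \<open>j \<in> C\<close> and \<open>A \<subseteq> C - {j}\<close>, where the maximum is over a nonempty set.\<close>

definition rel_quality ::
    "'a measure \<Rightarrow> 'i set \<Rightarrow> ('i \<Rightarrow> 'a \<Rightarrow> real) \<Rightarrow> 'i \<Rightarrow> 'i set \<Rightarrow> real" where
  "rel_quality P C T j A =
     \<P>(\<omega> in P. Max ((\<lambda>i. T i \<omega>) ` (C - A)) = T j \<omega> \<and>
               ereal (T j \<omega>) < (INF i\<in>A. ereal (T i \<omega>)))"

end

theory Submission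
  imports Defs
begin

text \<open>The sets \<open>A\<close> in the formula come in pairs. For fixed \<open>j \<in> M\<close> and \<open>B \<subseteq> C - {j}\<close>, the sets
  \<open>A = insert j B\<close> and \<open>A = B\<close> satisfy the cardinality condition together, namely when
  \<open>card (M - B) = k\<close>, and they carry the same factor \<open>q\<^sub>j(B)\<close> with opposite signs. So the right-hand
  side is the sum of \<open>q\<^sub>j(B) (\<phi>(B \<union> {j}) - \<phi>(B))\<close> over these \<open>j\<close> and \<open>B\<close>
  (\<open>signed_sum_over_subsets\<close>).

  The number \<open>q\<^sub>j(B)\<close> is the probability that \<open>B\<close> is exactly the set of components that outlive \<open>j\<close>
  (\<open>rel_quality_event_iff\<close>). At an outcome without ties, replace each \<open>q\<^sub>j(B)\<close> by the indicator of
  that event. For every \<open>j\<close> only \<open>B = {i. T\<^sub>i > T\<^sub>j}\<close> survives, and then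
  \<open>M - B = {i \<in> M. T\<^sub>i \<le> T\<^sub>j}\<close> has \<open>k\<close> elements just when \<open>T\<^sub>j\<close> is the \<open>k\<close>-th order statistic of
  \<open>M\<close>, which singles out one \<open>j\<close> (\<open>order_statistic_eq_iff_no_ties\<close>). For this \<open>j\<close> the difference
  \<open>\<phi>(B \<union> {j}) - \<phi>(B)\<close> compares the states of the system just before and just after time \<open>T\<^sub>j\<close>, so it
  is \<open>1\<close> if the system fails at that time and \<open>0\<close> otherwise (\<open>system_lifetime_jump\<close>). The whole sum
  is therefore the indicator of \<open>T\<^sub>C = T\<^bsub>k:M\<^esub>\<close>
  (\<open>lifetime_eq_order_statistic_expansion\<close>), and the theorem follows by taking expectations, ties
  having probability zero.\<close>

section \<open>Order statistics\<close>

text \<open>This lemma and the next turn a position in a sorted list into counts of entries, which no longer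
  depend on the sorting. The entries that satisfy the bound form an initial segment.\<close>

lemma nth_sorted_le_iff:
  fixes ys :: "'b::linorder list"
  assumes "sorted ys" "i < length ys"
  shows "ys ! i \<le> t \<longleftrightarrow> i < length (filter (\<lambda>y. y \<le> t) ys)"
  using assms
proof (induction ys arbitrary: i)
  case Nil
  then show ?case by simp
next
  case (Cons y ys)
  show ?case
  proof (cases "y \<le> t")
    case True
    then show ?thesis using Cons by (cases i) auto
  next
    case False
    then have "\<And>z. z \<in> set (y # ys) \<Longrightarrow> \<not> z \<le> t" using Cons.prems(1) by auto
    moreover have "(y # ys) ! i \<in> set (y # ys)" using Cons.prems(2) by (rule nth_mem)
    ultimately show ?thesis by (simp add: filter_False)
  qed
qed

lemma nth_sorted_less_iff:
  fixes ys :: "'b::linorder list"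
  assumes "sorted ys" "i < length ys"
  shows "ys ! i < t \<longleftrightarrow> i < length (filter (\<lambda>y. y < t) ys)"
  using assms
proof (induction ys arbitrary: i)
  case Nil
  then show ?case by simp
next
  case (Cons y ys)
  show ?case
  proof (cases "y < t")
    case True
    then show ?thesis using Cons by (cases i) auto
  next
    case False
    then have "\<And>z. z \<in> set (y # ys) \<Longrightarrow> \<not> z < t" using Cons.prems(1) by auto
    moreover have "(y # ys) ! i \<in> set (y # ys)" using Cons.prems(2) by (rule nth_mem)
    ultimately show ?thesis by (simp add: filter_False)
  qed
qed

lemma length_filter_sort_map_sorted_list_of_set:
  assumes "finite M"
  shows "length (filter Q (sort (map f (sorted_list_of_set M)))) = card {i\<in>M. Q (f i)}"
proof -
  have "length (filter Q (sort (map f (sorted_list_of_set M))))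
      = length (filter Q (map f (sorted_list_of_set M)))"
    by (metis mset_filter mset_sort size_mset)
  also have "\<dots> = length (filter (\<lambda>i. Q (f i)) (sorted_list_of_set M))"
    by (simp add: filter_map comp_def)
  also have "\<dots> = card (set (filter (\<lambda>i. Q (f i)) (sorted_list_of_set M)))"
    by (rule distinct_card[symmetric]) simp
  also have "set (filter (\<lambda>i. Q (f i)) (sorted_list_of_set M)) = {i\<in>M. Q (f i)}"
    using assms by auto
  finally show ?thesis .
qed

text \<open>The counts make sense for an arbitrary \<open>t\<close>, ties included, and depend on \<open>\<omega>\<close> through comparisons
  only, which is what makes the order statistic accessible to measurability arguments.\<close>

lemma order_statistic_eq_iff:
  assumes "finite M" "k \<in> {1..card M}"
  shows "order_statistic T M k \<omega> = t \<longleftrightarrow>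
    card {i\<in>M. T i \<omega> < t} < k \<and> k \<le> card {i\<in>M. T i \<omega> \<le> t}"
proof -
  define ys where "ys = sort (map (\<lambda>i. T i \<omega>) (sorted_list_of_set M))"
  have sorted: "sorted ys" and index: "k - 1 < length ys"
    using assms by (auto simp: ys_def)
  have "order_statistic T M k \<omega> = t \<longleftrightarrow> ys ! (k - 1) \<le> t \<and> \<not> ys ! (k - 1) < t"
    by (auto simp: order_statistic_def ys_def)
  also have "\<dots> \<longleftrightarrow> k - 1 < card {i\<in>M. T i \<omega> \<le> t} \<and> \<not> k - 1 < card {i\<in>M. T i \<omega> < t}"
    unfolding nth_sorted_le_iff[OF sorted index] nth_sorted_less_iff[OF sorted index]
    by (simp add: ys_def length_filter_sort_map_sorted_list_of_set assms(1))
  finally show ?thesis using assms(2) by auto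
qed

lemma order_statistic_attained:
  assumes "finite M" "k \<in> {1..card M}"
  shows "\<exists>j\<in>M. T j \<omega> = order_statistic T M k \<omega>"
proof -
  have "k - 1 < length (sort (map (\<lambda>i. T i \<omega>) (sorted_list_of_set M)))"
    using assms by auto
  from nth_mem[OF this] show ?thesis
    using assms(1) by (auto simp: order_statistic_def)
qed

text \<open>Without ties the two counts at \<open>t = T j \<omega>\<close> differ by exactly one, the contribution of \<open>j\<close>
  itself, so the strict bound on the smaller count becomes an upper bound on the larger one.\<close>

lemma order_statistic_eq_iff_no_ties:
  assumes "finite M" "k \<in> {1..card M}" "j \<in> M" "inj_on (\<lambda>i. T i \<omega>) M"
  shows "order_statistic T M k \<omega> = T j \<omega> \<longleftrightarrow> card {i\<in>M. T i \<omega> \<le> T j \<omega>} = k"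
proof -
  have "{i\<in>M. T i \<omega> \<le> T j \<omega>} = insert j {i\<in>M. T i \<omega> < T j \<omega>}"
    using assms(3,4) by (auto simp: inj_on_def order.order_iff_strict)
  then have "card {i\<in>M. T i \<omega> \<le> T j \<omega>} = Suc (card {i\<in>M. T i \<omega> < T j \<omega>})"
    using assms(1) by simp
  then show ?thesis using order_statistic_eq_iff[OF assms(1,2), of T \<omega> "T j \<omega>"] by auto
qed

section \<open>System lifetime and the structure function\<close>

lemma semicoherent_values:
  "semicoherent C \<phi> \<Longrightarrow> A \<subseteq> C \<Longrightarrow> \<phi> A = 0 \<or> \<phi> A = 1"
  by (simp add: semicoherent_def)

lemma semicoherent_mono:
  assumes "semicoherent C \<phi>" "A \<subseteq> B" "B \<subseteq> C"
  shows "\<phi> A \<le> \<phi> B"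
proof -
  have "finite (B - A)"
    using assms by (auto simp: semicoherent_def intro: finite_subset)
  moreover have "finite D \<Longrightarrow> D \<subseteq> C - A \<Longrightarrow> \<phi> A \<le> \<phi> (A \<union> D)" for D
  proof (induction D rule: finite_induct)
    case empty
    then show ?case by simp
  next
    case (insert i D)
    then have "A \<union> D \<subseteq> C" "i \<in> C" "i \<notin> A \<union> D" using assms by auto
    then have "\<phi> (A \<union> D) \<le> \<phi> ((A \<union> D) \<union> {i})"
      using assms(1) unfolding semicoherent_def by (metis Diff_insert_absorb Diff_empty Diff_insert0)
    then show ?case using insert by simp
  qed
  ultimately have "\<phi> A \<le> \<phi> (A \<union> (B - A))" using assms by blast
  then show ?thesis using assms(2) by (simp add: Un_absorb1)
qed

text \<open>By monotonicity, the largest set with the property \<open>Q\<close> is the best candidate.\<close>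

lemma semicoherent_path_set_bound:
  assumes "semicoherent C \<phi>"
  shows "(\<exists>A. A \<subseteq> C \<and> \<phi> A = 1 \<and> (\<forall>i\<in>A. Q i)) \<longleftrightarrow> \<phi> {i\<in>C. Q i} = 1"
proof
  assume "\<exists>A. A \<subseteq> C \<and> \<phi> A = 1 \<and> (\<forall>i\<in>A. Q i)"
  then obtain A where A: "A \<subseteq> C" "\<phi> A = 1" "\<forall>i\<in>A. Q i" by blast
  then have "\<phi> A \<le> \<phi> {i\<in>C. Q i}" by (intro semicoherent_mono[OF assms]) auto
  moreover have "\<phi> {i\<in>C. Q i} = 0 \<or> \<phi> {i\<in>C. Q i} = 1"
    by (intro semicoherent_values[OF assms]) auto
  ultimately show "\<phi> {i\<in>C. Q i} = 1" using A(2) by auto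
next
  assume "\<phi> {i\<in>C. Q i} = 1"
  then show "\<exists>A. A \<subseteq> C \<and> \<phi> A = 1 \<and> (\<forall>i\<in>A. Q i)"
    by (intro exI[of _ "{i\<in>C. Q i}"]) auto
qed

text \<open>The system outlives \<open>t\<close> if and only if the components that outlive \<open>t\<close> suffice to operate it.
  Both the weak and the strict form are needed to locate the lifetime at a single value.\<close>

lemma system_lifetime_threshold:
  assumes "semicoherent C \<phi>"
  shows "t \<le> system_lifetime C \<phi> T \<omega> \<longleftrightarrow> \<phi> {i\<in>C. t \<le> T i \<omega>} = 1"
    and "t < system_lifetime C \<phi> T \<omega> \<longleftrightarrow> \<phi> {i\<in>C. t < T i \<omega>} = 1"
proof -
  have fin: "finite C" using assms by (simp add: semicoherent_def)
  let ?paths = "{A. A \<subseteq> C \<and> \<phi> A = 1}"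
  have paths: "finite ?paths" "?paths \<noteq> {}"
    using assms fin by (auto simp: semicoherent_def)
  have path: "finite A" "A \<noteq> {}" if "A \<in> ?paths" for A
    using that assms fin by (auto simp: semicoherent_def intro: finite_subset)
  have "t \<le> system_lifetime C \<phi> T \<omega> \<longleftrightarrow> (\<exists>A\<in>?paths. t \<le> Min ((\<lambda>i. T i \<omega>) ` A))"
    unfolding system_lifetime_def using paths by (subst Max_ge_iff) auto
  also have "\<dots> \<longleftrightarrow> (\<exists>A\<in>?paths. \<forall>i\<in>A. t \<le> T i \<omega>)"
    using path by (intro bex_cong refl) auto
  finally show "t \<le> system_lifetime C \<phi> T \<omega> \<longleftrightarrow> \<phi> {i\<in>C. t \<le> T i \<omega>} = 1"
    using semicoherent_path_set_bound[OF assms, of "\<lambda>i. t \<le> T i \<omega>"] by auto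
  have "t < system_lifetime C \<phi> T \<omega> \<longleftrightarrow> (\<exists>A\<in>?paths. t < Min ((\<lambda>i. T i \<omega>) ` A))"
    unfolding system_lifetime_def using paths by (subst Max_gr_iff) auto
  also have "\<dots> \<longleftrightarrow> (\<exists>A\<in>?paths. \<forall>i\<in>A. t < T i \<omega>)"
    using path by (intro bex_cong refl) auto
  finally show "t < system_lifetime C \<phi> T \<omega> \<longleftrightarrow> \<phi> {i\<in>C. t < T i \<omega>} = 1"
    using semicoherent_path_set_bound[OF assms, of "\<lambda>i. t < T i \<omega>"] by auto
qed

text \<open>The state of the system as a function of time drops from \<open>1\<close> to \<open>0\<close> exactly once, at its lifetime.\<close>

lemma system_lifetime_jump:
  assumes "semicoherent C \<phi>"
  shows "real (\<phi> {i\<in>C. t \<le> T i \<omega>}) - real (\<phi> {i\<in>C. t < T i \<omega>})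
    = of_bool (system_lifetime C \<phi> T \<omega> = t)"
proof -
  have "\<phi> {i\<in>C. t \<le> T i \<omega>} = 0 \<or> \<phi> {i\<in>C. t \<le> T i \<omega>} = 1"
    and "\<phi> {i\<in>C. t < T i \<omega>} = 0 \<or> \<phi> {i\<in>C. t < T i \<omega>} = 1"
    by (intro semicoherent_values[OF assms]; auto)+
  then show ?thesis
    using system_lifetime_threshold[OF assms, of t T \<omega>] by auto
qed

section \<open>Reduction to indicators\<close>

text \<open>The bound on the maximum says that no component outside \<open>B\<close> outlives \<open>j\<close>, and the one on the
  infimum that every component in \<open>B\<close> does. The maximum cannot be smaller than \<open>T j \<omega>\<close>, because \<open>j\<close>
  lies outside \<open>B\<close>. In this form the events for different \<open>B\<close> are visibly disjoint.\<close>

lemma rel_quality_event_iff: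
  assumes "finite C" "j \<in> C" "B \<subseteq> C - {j}"
  shows "Max ((\<lambda>i. T i \<omega>) ` (C - B)) = T j \<omega> \<and> ereal (T j \<omega>) < (INF i\<in>B. ereal (T i \<omega>))
    \<longleftrightarrow> B = {i\<in>C. T j \<omega> < T i \<omega>}"
proof -
  have fin: "finite (C - B)" "finite B" using assms by (auto intro: finite_subset)
  have "Max ((\<lambda>i. T i \<omega>) ` (C - B)) = T j \<omega> \<longleftrightarrow> (\<forall>i\<in>C - B. T i \<omega> \<le> T j \<omega>)"
    using fin assms by (subst Max_eq_iff) auto
  moreover have "ereal (T j \<omega>) < (INF i\<in>B. ereal (T i \<omega>)) \<longleftrightarrow> (\<forall>i\<in>B. T j \<omega> < T i \<omega>)"
  proof (cases "B = {}")
    case True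
    then show ?thesis by (simp add: top_ereal_def)
  next
    case False
    then have "(INF i\<in>B. ereal (T i \<omega>)) = Min ((\<lambda>i. ereal (T i \<omega>)) ` B)"
      using fin by (intro cInf_eq_Min) auto
    then show ?thesis using False fin by simp
  qed
  moreover have "(\<forall>i\<in>C - B. T i \<omega> \<le> T j \<omega>) \<and> (\<forall>i\<in>B. T j \<omega> < T i \<omega>)
      \<longleftrightarrow> B = {i\<in>C. T j \<omega> < T i \<omega>}"
  proof (intro iffI)
    assume "(\<forall>i\<in>C - B. T i \<omega> \<le> T j \<omega>) \<and> (\<forall>i\<in>B. T j \<omega> < T i \<omega>)"
    then show "B = {i\<in>C. T j \<omega> < T i \<omega>}" using assms(3) by (blast dest: leD)
  next
    assume B: "B = {i\<in>C. T j \<omega> < T i \<omega>}"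
    show "(\<forall>i\<in>C - B. T i \<omega> \<le> T j \<omega>) \<and> (\<forall>i\<in>B. T j \<omega> < T i \<omega>)"
      unfolding B by (auto simp: not_less)
  qed
  ultimately show ?thesis by (simp only:)
qed

text \<open>The index sets with and without \<open>j\<close> correspond through \<open>B \<mapsto> insert j B\<close>: if \<open>j \<notin> B\<close>, then
  \<open>(M - A) \<union> {j} = M - B\<close> for both \<open>A = insert j B\<close> and \<open>A = B\<close>. Only the second one has the sign
  \<open>-1\<close>.\<close>

lemma signed_sum_over_subsets:
  fixes q :: "'i set \<Rightarrow> real"
  assumes "finite C" "j \<in> M" "M \<subseteq> C"
  shows "(\<Sum>A | A \<subseteq> C \<and> card ((M - A) \<union> {j}) = k.
      (-1) ^ card ({j} - A) * q (A - {j}) * real (\<phi> A))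
    = (\<Sum>B | B \<subseteq> C - {j} \<and> card (M - B) = k. q B * (real (\<phi> (insert j B)) - real (\<phi> B)))"
    (is "sum ?f ?S = sum ?g ?R")
proof -
  have finR: "finite ?R" using assms(1) by auto
  have S: "?S = insert j ` ?R \<union> ?R"
  proof (intro equalityI subsetI)
    fix A assume A: "A \<in> ?S"
    show "A \<in> insert j ` ?R \<union> ?R"
    proof (cases "j \<in> A")
      case True
      have "(M - A) \<union> {j} = M - (A - {j})" using assms True by auto
      then have "A - {j} \<in> ?R" using A by auto
      moreover have "A = insert j (A - {j})" using True by auto
      ultimately show ?thesis by blast
    next
      case False
      then have "(M - A) \<union> {j} = M - A" using assms by auto
      then show ?thesis using A False by auto
    qed
  next
    fix A assume "A \<in> insert j ` ?R \<union> ?R"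
    then consider B where "B \<in> ?R" "A = insert j B" | "A \<in> ?R" by blast
    then show "A \<in> ?S"
    proof cases
      case 1
      then have "(M - A) \<union> {j} = M - B" using assms by auto
      then show ?thesis using 1 assms by auto
    next
      case 2
      then have "(M - A) \<union> {j} = M - A" using assms by auto
      then show ?thesis using 2 by auto
    qed
  qed
  have inj: "inj_on (insert j) ?R" by (auto simp: inj_on_def)
  have mem: "B - {j} = B" "{j} - B = {j}" if "B \<in> ?R" for B using that by auto
  have "sum ?f ?S = sum ?f (insert j ` ?R) + sum ?f ?R"
    unfolding S using finR by (intro sum.union_disjoint) auto
  also have "sum ?f (insert j ` ?R) = (\<Sum>B\<in>?R. ?f (insert j B))"
    using sum.reindex[OF inj, of ?f] by (simp only: comp_def)
  also have "\<dots> = (\<Sum>B\<in>?R. q B * real (\<phi> (insert j B)))"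
  proof (rule sum.cong[OF refl])
    fix B assume "B \<in> ?R"
    then have "insert j B - {j} = B" "{j} - insert j B = {}" by auto
    then show "?f (insert j B) = q B * real (\<phi> (insert j B))" by (simp only:) simp
  qed
  also have "sum ?f ?R = (\<Sum>B\<in>?R. - (q B * real (\<phi> B)))"
  proof (rule sum.cong[OF refl])
    fix B assume "B \<in> ?R"
    then show "?f B = - (q B * real (\<phi> B))" by (simp only: mem) simp
  qed
  finally show ?thesis
    by (simp only: sum.distrib[symmetric] right_diff_distrib add_uminus_conv_diff)
qed

text \<open>The pointwise form of the theorem. Without ties there is exactly one \<open>j0 \<in> M\<close> that fails as the
  \<open>k\<close>-th component of \<open>M\<close>, and all terms of the double sum vanish except the one for \<open>j0\<close> and the set
  of components that outlive it. What remains is the jump of the structure function at the failure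
  time of \<open>j0\<close>.\<close>

lemma lifetime_eq_order_statistic_expansion:
  assumes "semicoherent C \<phi>" "M \<subseteq> C" "k \<in> {1..card M}" "inj_on (\<lambda>i. T i \<omega>) C"
  shows "(of_bool (system_lifetime C \<phi> T \<omega> = order_statistic T M k \<omega>) :: real) =
    (\<Sum>j\<in>M. \<Sum>B | B \<subseteq> C - {j} \<and> card (M - B) = k.
       of_bool (B = {i\<in>C. T j \<omega> < T i \<omega>}) * (real (\<phi> (insert j B)) - real (\<phi> B)))"
proof -
  have finC: "finite C" using assms(1) by (simp add: semicoherent_def)
  then have finM: "finite M" using assms(2) finite_subset by blast
  have injM: "inj_on (\<lambda>i. T i \<omega>) M" using assms(2,4) inj_on_subset by blast
  obtain j0 where j0: "j0 \<in> M" "T j0 \<omega> = order_statistic T M k \<omega>"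
    using order_statistic_attained[OF finM assms(3), of T \<omega>] by (elim bexE)
  have collapse: "(\<Sum>B | B \<subseteq> C - {j} \<and> card (M - B) = k.
       of_bool (B = {i\<in>C. T j \<omega> < T i \<omega>}) * (real (\<phi> (insert j B)) - real (\<phi> B)))
      = of_bool (j = j0) * of_bool (system_lifetime C \<phi> T \<omega> = order_statistic T M k \<omega>)"
    (is "?lhs = _") if j: "j \<in> M" for j
  proof -
    let ?U = "{i\<in>C. T j \<omega> < T i \<omega>}"
    have "M - ?U = {i\<in>M. T i \<omega> \<le> T j \<omega>}" using assms(2) by auto
    moreover have "order_statistic T M k \<omega> = T j \<omega> \<longleftrightarrow> j = j0"
      unfolding j0(2)[symmetric] using inj_on_eq_iff[OF injM j j0(1)] by auto
    ultimately have card_U: "card (M - ?U) = k \<longleftrightarrow> j = j0"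
      using order_statistic_eq_iff_no_ties[where T = T and \<omega> = \<omega>, OF finM assms(3) j injM]
      by simp
    have "?lhs = (\<Sum>B | B \<subseteq> C - {j} \<and> card (M - B) = k.
        if ?U = B then real (\<phi> (insert j B)) - real (\<phi> B) else 0)"
      by (intro sum.cong refl) (simp only: of_bool_def split: if_split, simp)
    also have "\<dots> = of_bool (card (M - ?U) = k) * (real (\<phi> (insert j ?U)) - real (\<phi> ?U))"
    proof (subst sum.delta')
      show "finite {B. B \<subseteq> C - {j} \<and> card (M - B) = k}" using finC by simp
      have "?U \<subseteq> C - {j}" by auto
      then show "(if ?U \<in> {B. B \<subseteq> C - {j} \<and> card (M - B) = k}
          then real (\<phi> (insert j ?U)) - real (\<phi> ?U) else 0)
        = of_bool (card (M - ?U) = k) * (real (\<phi> (insert j ?U)) - real (\<phi> ?U))"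
        by (simp only: mem_Collect_eq of_bool_def simp_thms) simp
    qed
    also have "\<dots> = of_bool (j = j0) * (real (\<phi> (insert j ?U)) - real (\<phi> ?U))"
      by (simp only: card_U)
    also have "\<dots> = of_bool (j = j0) * of_bool (system_lifetime C \<phi> T \<omega> = order_statistic T M k \<omega>)"
    proof (cases "j = j0")
      case True
      have "{i\<in>C. T j \<omega> \<le> T i \<omega>} = insert j ?U"
        using assms(2,4) j by (auto simp: inj_on_def order.order_iff_strict)
      then show ?thesis
        using system_lifetime_jump[OF assms(1), of "T j \<omega>" T \<omega>] True j0(2) by simp
    qed simp
    finally show ?thesis .
  qed
  show ?thesis
    using j0(1) finM by (simp add: collapse sum_distrib_right[symmetric])
qed

section \<open>Measurability and absence of ties\<close>

lemma borel_measurable_system_lifetime: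
  assumes "semicoherent C \<phi>" "\<And>i. i \<in> C \<Longrightarrow> T i \<in> borel_measurable P"
  shows "(\<lambda>\<omega>. system_lifetime C \<phi> T \<omega>) \<in> borel_measurable P"
proof -
  have "{\<omega> \<in> space P. t < system_lifetime C \<phi> T \<omega>} \<in> sets P" for t
  proof -
    have "finite C" using assms(1) by (simp add: semicoherent_def)
    \<comment> \<open>The right-hand set is a finite Boolean combination of the measurable sets where \<open>T i\<close> exceeds \<open>t\<close>.\<close>
    have "{\<omega> \<in> space P. t < system_lifetime C \<phi> T \<omega>}
        = {\<omega> \<in> space P. \<exists>A\<in>{A. A \<subseteq> C \<and> \<phi> A = 1}. \<forall>i\<in>A. t < T i \<omega>}"
      unfolding system_lifetime_threshold(2)[OF assms(1)] Bex_def mem_Collect_eq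
      using semicoherent_path_set_bound[OF assms(1)] by (simp add: conj_assoc)
    also have "\<dots> \<in> sets P"
    proof (intro sets.sets_Collect_finite_Ex sets.sets_Collect_finite_All)
    qed (use \<open>finite C\<close> assms(2) in \<open>auto intro: finite_subset\<close>)
    finally show ?thesis .
  qed
  then show ?thesis by (simp add: borel_measurable_iff_greater)
qed

text \<open>The probability of this event can be computed as the expectation of an almost surely equal function
  only once the event is known to be measurable. The counts in \<open>order_statistic_eq_iff\<close> are written
  as finite sums of indicators, so that the sorting disappears.\<close>

lemma sets_system_lifetime_eq_order_statistic:
  assumes "semicoherent C \<phi>" "\<And>i. i \<in> C \<Longrightarrow> T i \<in> borel_measurable P"
    and "M \<subseteq> C" "k \<in> {1..card M}"
  shows "{\<omega>\<in>space P. system_lifetime C \<phi> T \<omega> = order_statistic T M k \<omega>} \<in> sets P"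
proof -
  have finM: "finite M"
    using assms(1,3) by (auto simp: semicoherent_def intro: finite_subset)
  note [measurable] = borel_measurable_system_lifetime[OF assms(1,2)]
  have [measurable]: "\<And>i. i \<in> M \<Longrightarrow> T i \<in> borel_measurable P" using assms by auto
  let ?S = "\<lambda>\<omega>. system_lifetime C \<phi> T \<omega>"
  have "system_lifetime C \<phi> T \<omega> = order_statistic T M k \<omega> \<longleftrightarrow>
      (\<Sum>i\<in>M. of_bool (T i \<omega> < ?S \<omega>)) < real k \<and> real k \<le> (\<Sum>i\<in>M. of_bool (T i \<omega> \<le> ?S \<omega>))" for \<omega>
    using order_statistic_eq_iff[OF finM assms(4), of T \<omega> "?S \<omega>"] finM
    by (auto simp: Int_def conj_commute)
  then show ?thesis by (simp add: of_bool_def) measurable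
qed

lemma AE_inj_on_of_no_ties:
  fixes T :: "'i \<Rightarrow> 'a \<Rightarrow> real"
  assumes "prob_space P" "finite C" "\<And>i. i \<in> C \<Longrightarrow> T i \<in> borel_measurable P"
    and "\<And>i j. i \<in> C \<Longrightarrow> j \<in> C \<Longrightarrow> i \<noteq> j \<Longrightarrow> \<P>(\<omega> in P. T i \<omega> = T j \<omega>) = 0"
  shows "AE \<omega> in P. inj_on (\<lambda>i. T i \<omega>) C"
proof -
  interpret prob_space P by fact
  have "AE \<omega> in P. T i \<omega> \<noteq> T j \<omega>" if ij: "i \<in> C" "j \<in> C" "i \<noteq> j" for i j
  proof -
    note [measurable] = assms(3)[OF ij(1)] assms(3)[OF ij(2)]
    have "{\<omega>\<in>space P. T i \<omega> = T j \<omega>} \<in> events" by measurable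
    then show ?thesis using assms(4)[OF ij]
      by (subst AE_iff_measurable[OF _ refl]) (auto simp: emeasure_eq_measure)
  qed
  then have "AE \<omega> in P. \<forall>i\<in>C. \<forall>j\<in>C. i \<noteq> j \<longrightarrow> T i \<omega> \<noteq> T j \<omega>"
    using assms(2) by (intro AE_finite_allI) auto
  then show ?thesis by eventually_elim (auto simp: inj_on_def)
qed

section \<open>The formula\<close>

theorem corollary5:
  fixes P :: "'a measure" and n :: nat and C :: "nat set"
    and \<phi> :: "nat set \<Rightarrow> nat" and T :: "nat \<Rightarrow> 'a \<Rightarrow> real"
    and M :: "nat set" and k :: nat
  assumes "prob_space P"
    and "C = {1..n}"
    and "semicoherent C \<phi>"
    and "\<And>i. i \<in> C \<Longrightarrow> T i \<in> borel_measurable P"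
    and "\<And>i \<omega>. i \<in> C \<Longrightarrow> \<omega> \<in> space P \<Longrightarrow> 0 \<le> T i \<omega>"
    and "\<And>i j. i \<in> C \<Longrightarrow> j \<in> C \<Longrightarrow> i \<noteq> j \<Longrightarrow> \<P>(\<omega> in P. T i \<omega> = T j \<omega>) = 0"
    and "M \<subseteq> C" and "M \<noteq> {}"
    and "k \<in> {1..card M}"
  shows "\<P>(\<omega> in P. system_lifetime C \<phi> T \<omega> = order_statistic T M k \<omega>) =
    (\<Sum>j\<in>M. \<Sum>A | A \<subseteq> C \<and> card ((M - A) \<union> {j}) = k.
       (-1) ^ card ({j} - A) * rel_quality P C T j (A - {j}) * real (\<phi> A))"
proof -
  interpret prob_space P by fact
  have finC: "finite C" using assms(2) by simp
  let ?E = "{\<omega>\<in>space P. system_lifetime C \<phi> T \<omega> = order_statistic T M k \<omega>}"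
  let ?Q = "\<lambda>j B. {\<omega>\<in>space P. B = {i\<in>C. T j \<omega> < T i \<omega>}}"
  let ?\<Delta> = "\<lambda>j B. real (\<phi> (insert j B)) - real (\<phi> B)"
  have no_ties: "AE \<omega> in P. inj_on (\<lambda>i. T i \<omega>) C"
    using assms(4,6) by (intro AE_inj_on_of_no_ties[OF assms(1) finC]) auto
  have E: "?E \<in> events"
    using assms by (intro sets_system_lifetime_eq_order_statistic) auto
  have Q: "?Q j B \<in> events" if "j \<in> C" "B \<subseteq> C" for j B
  proof -
    have "?Q j B = {\<omega>\<in>space P. \<forall>i\<in>C. i \<in> B \<longleftrightarrow> T j \<omega> < T i \<omega>}" using that by blast
    also have "\<dots> \<in> events"
      using finC assms(4) that by measurable
    finally show ?thesis .
  qed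
  have quality: "rel_quality P C T j B = prob (?Q j B)" if "j \<in> C" "B \<subseteq> C - {j}" for j B
    unfolding rel_quality_def rel_quality_event_iff[OF finC that] ..
  have "prob ?E = (\<integral>\<omega>. indicator ?E \<omega> \<partial>P)" using E by simp
  also have "\<dots> = (\<integral>\<omega>. (\<Sum>j\<in>M. \<Sum>B | B \<subseteq> C - {j} \<and> card (M - B) = k.
      indicator (?Q j B) \<omega> * ?\<Delta> j B) \<partial>P)"
  proof (rule integral_cong_AE)
    show "AE \<omega> in P. indicator ?E \<omega> = (\<Sum>j\<in>M. \<Sum>B | B \<subseteq> C - {j} \<and> card (M - B) = k.
      indicator (?Q j B) \<omega> * ?\<Delta> j B)"
      using no_ties AE_space
    proof eventually_elim
      case (elim \<omega>)
      from lifetime_eq_order_statistic_expansion[where T = T and \<omega> = \<omega>, OF assms(3,7,9) elim(1)]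
      show ?case using elim(2) by (simp add: indicator_def of_bool_def)
    qed
    show "indicator ?E \<in> borel_measurable P" using E by simp
    show "(\<lambda>\<omega>. \<Sum>j\<in>M. \<Sum>B | B \<subseteq> C - {j} \<and> card (M - B) = k.
      indicator (?Q j B) \<omega> * ?\<Delta> j B) \<in> borel_measurable P"
      using Q assms(7)
      by (intro borel_measurable_sum borel_measurable_times borel_measurable_indicator) auto
  qed
  also have "\<dots> = (\<Sum>j\<in>M. \<Sum>B | B \<subseteq> C - {j} \<and> card (M - B) = k. prob (?Q j B) * ?\<Delta> j B)"
  proof -
    have int: "integrable P (\<lambda>\<omega>. indicator (?Q j B) \<omega> * ?\<Delta> j B)"
      if "j \<in> M" "B \<in> {B. B \<subseteq> C - {j} \<and> card (M - B) = k}" for j B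
      using that Q[of j B] assms(7) by (intro integrable_mult_left integrable_real_indicator)
        (auto simp: emeasure_eq_measure)
    have int_eq: "(\<integral>\<omega>. indicator (?Q j B) \<omega> * ?\<Delta> j B \<partial>P) = prob (?Q j B) * ?\<Delta> j B"
      if "j \<in> M" "B \<in> {B. B \<subseteq> C - {j} \<and> card (M - B) = k}" for j B
    proof -
      have "?Q j B \<inter> space P = ?Q j B" by auto
      moreover have "?Q j B \<in> events" using that assms(7) by (intro Q) auto
      ultimately show ?thesis by simp
    qed
    have "(\<integral>\<omega>. (\<Sum>j\<in>M. \<Sum>B | B \<subseteq> C - {j} \<and> card (M - B) = k.
        indicator (?Q j B) \<omega> * ?\<Delta> j B) \<partial>P)
      = (\<Sum>j\<in>M. \<integral>\<omega>. (\<Sum>B | B \<subseteq> C - {j} \<and> card (M - B) = k.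
        indicator (?Q j B) \<omega> * ?\<Delta> j B) \<partial>P)"
      by (intro Bochner_Integration.integral_sum Bochner_Integration.integrable_sum int)
    also have "\<dots> = (\<Sum>j\<in>M. \<Sum>B | B \<subseteq> C - {j} \<and> card (M - B) = k.
        \<integral>\<omega>. indicator (?Q j B) \<omega> * ?\<Delta> j B \<partial>P)"
      by (intro sum.cong refl Bochner_Integration.integral_sum int)
    also have "\<dots> = (\<Sum>j\<in>M. \<Sum>B | B \<subseteq> C - {j} \<and> card (M - B) = k. prob (?Q j B) * ?\<Delta> j B)"
      by (intro sum.cong refl int_eq)
    finally show ?thesis .
  qed
  also have "\<dots> = (\<Sum>j\<in>M. \<Sum>B | B \<subseteq> C - {j} \<and> card (M - B) = k.
      rel_quality P C T j B * ?\<Delta> j B)"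
    using quality assms(7) by (intro sum.cong refl) auto
  also have "\<dots> = (\<Sum>j\<in>M. \<Sum>A | A \<subseteq> C \<and> card ((M - A) \<union> {j}) = k.
       (-1) ^ card ({j} - A) * rel_quality P C T j (A - {j}) * real (\<phi> A))"
    by (rule sum.cong[OF refl], rule signed_sum_over_subsets[OF finC _ assms(7), symmetric])
  finally show ?thesis .
qed

end
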